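(* Let $X,Y$ be finite dimensional normed spaces, $\Omega\subseteq X$ a closed set, $F:X\rightrightarrows Y$ a closed-graph set-valued mapping, $Q:Y\rightrightarrows Y$ a closed-graph variable domination structure, and $(\overline{x},\overline{y})\in X\times Y$ such that $\overline{x}\in\Omega$, $(\overline{x},\overline{y})\in\operatorname{Gr}F$, $(\overline{y},0)\in\operatorname{Gr}Q$. Moreover, suppose that the following conditions are satisfied: (a) (Aubin conditions) $F$ and $Q$ have the Aubin property around $(\overline{x},\overline{y})$ and $(\overline{y},0)$, respectively. (b) (Constants conditions) There exist $\varepsilon\in(0,\infty]$ and $\delta\in(0,\infty)$ such that one of the following sets of conditions holds: (b.i) $\varepsilon>\frac1{16}$ and $\delta\in(0,\frac14)$; (b.ii) $\delta<\varepsilon$ and $\sqrt{\delta}-\delta<\varepsilon$. (c) (Interiority condition) For $\varepsilon$ from above, denote $P:=\bigcap_{y\in B(\overline{y},\varepsilon)}Q(y)$ and suppose that $q\in S_Y\cap\operatorname{int}P$. (d) (Approximate solution condition) $(\overline{x},\overline{y})$ is an $(\varepsilon,\delta,q)$-nondominated solution with respect to $Q$ for $F$ on $\Omega$. Let $\varphi:[0,\infty)\to[0,\frac14)$ be the increasing continuous bijection $$\varphi(x):=\frac14\left(\sqrt{1+x}-1\right)\left(\frac{1}{\sqrt{x+1}}-\frac{1}{x+1}\right).$$ Then there exist $y^{\ast}\in P^{+}$ with $\langle y^{\ast},q\rangle=1$, $(x_1,y_1)\in\operatorname{Gr}F\cap[\overline{B}(\overline{x},\varphi^{-1}(\delta))\times\overline{B}(\overline{y},\varphi^{-1}(\delta))]$,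 $(y_2,z_2)\in\operatorname{Gr}Q\cap[\overline{B}(\overline{y},\varphi^{-1}(\delta))\times\overline{B}(0,\varphi^{-1}(\delta))]$, $x_3\in\Omega\cap\overline{B}(\overline{x},\varphi^{-1}(\delta))$, $z^{\ast}\in2\varphi^{-1}(\delta)\overline{B}_{Y^{\ast}}$, and $y_1^{\ast}\in\widehat{D}^{\ast}Q(y_2,z_2)(y^{\ast})+\varphi^{-1}(\delta)\overline{B}_{Y^{\ast}}$ such that $$0\in D^{\ast}F(x_1,y_1)(y^{\ast}+y_1^{\ast}+z^{\ast})+N(\Omega,x_3)+\varphi^{-1}(\delta)\overline{B}_{X^{\ast}}.$$
   Context: $B(x,r)$ and $\overline{B}(x,r)$ are the open and closed balls, with $B(\cdot,+\infty)$ the whole space; $S_Y$ is the unit sphere of $Y$; $X^{\ast},Y^{\ast}$ are the topological duals; $\overline{B}_{X^{\ast}},\overline{B}_{Y^{\ast}},\overline{B}_Y$ are closed unit balls; $\operatorname{Gr}F=\{(x,y)\mid y\in F(x)\}$; $P^{+}:=\{y^{\ast}\in Y^{\ast}\mid\langle y^{\ast},y\rangle\ge0\ \forall y\in P\}$. A variable domination structure is a set-valued mapping whose values are closed, convex, proper and pointed cones (a cone $C$ is pointed if $C\cap(-C)=\{0\}$). $(\overline{x},\overline{y})\in\operatorname{Gr}F\cap(\Omega\times Y)$ is an $(\varepsilon,\delta,q)$-nondominated solution with respect to $Q$ for $F$ on $\Omega$ (where $q\in Y\setminus\{0\}$) if for every $x\in B(\overline{x},\varepsilon)\cap\Omega$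 and every $y\in F(x)\setminus\{\overline{y}\}$, $\overline{y}-\delta q\notin y+(Q(y)\setminus\{0\})$. A set-valued mapping $F$ has the Aubin property around $(\overline{x},\overline{y})\in\operatorname{Gr}F$ if there are $\ell>0$ and neighborhoods $U$ of $\overline{x}$ and $V$ of $\overline{y}$ such that $F(x)\cap V\subseteq F(u)+\ell\|x-u\|\overline{B}_Y$ for all $x,u\in U$ (likewise for $Q$ around $(\overline{y},0)$). Fréchet normal cone: for $x\in S$, $\widehat{N}(S,x):=\{x^{\ast}\mid\limsup_{u\to x,\,u\in S}\frac{\langle x^{\ast},u-x\rangle}{\|u-x\|}\le0\}$. Limiting (Mordukhovich) normal cone, for $S$ closed around $x\in S$: $N(S,x):=\{x^{\ast}\mid\exists x_n\to x,\ x_n\in S,\ x_n^{\ast}\to x^{\ast}\text{ (weak}^{\ast}),\ x_n^{\ast}\in\widehat{N}(S,x_n)\ \forall n\}$. Fréchet coderivative of $Q$ at $(y,z)\in\operatorname{Gr}Q$: $\widehat{D}^{\ast}Q(y,z)(z^{\ast}):=\{v^{\ast}\in Y^{\ast}\mid(v^{\ast},-z^{\ast})\in\widehat{N}(\operatorname{Gr}Q,(y,z))\}$. Mordukhovich coderivative of $F$ at $(x,y)\in\operatorname{Gr}F$: $D^{\ast}F(x,y)(y^{\ast}):=\{x^{\ast}\in X^{\ast}\mid(x^{\ast},-y^{\ast})\in N(\operatorname{Gr}F,(x,y))\}$.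
   Formalization: In case (b.ii), the formal statement additionally requires δ to lie in the range [0,1/4) of φ, i.e. δ < 1/4, since φ⁻¹(δ) is otherwise undefined (e.g. δ = 1, ε = 2 satisfies (b.ii)). *)

theory Defs
  imports "HOL-Analysis.Analysis"
begin

text \<open>
  Set-valued maps are functions into sets, and the topological dual of \<open>'a\<close> is
  \<open>'a \<Rightarrow>\<^sub>L real\<close>, whose norm is the dual (operator) norm. Sums of sets are Minkowski sums
  from \<open>Set_Algebras\<close>. Norms are arbitrary, so the spaces are in
  \<open>real_normed_vector\<close> and not in \<open>euclidean_space\<close>.
\<close>

definition finite_dim :: "'a::real_normed_vector itself \<Rightarrow> bool" where
  "finite_dim _ \<longleftrightarrow> (\<exists>B :: 'a set. finite B \<and> span B = UNIV)"

definition Gr :: "('a \<Rightarrow> 'b set) \<Rightarrow> ('a \<times> 'b) set" where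
  "Gr F = {(x, y). y \<in> F x}"

definition pointed :: "'a::real_vector set \<Rightarrow> bool" where
  "pointed C \<longleftrightarrow> C \<inter> uminus ` C = {0}"

text \<open>
  ``Proper'' means \<open>C \<noteq> UNIV\<close>; that \<open>C\<close> is nonempty (which \<open>cone\<close> does not demand)
  follows from pointedness, whereas \<open>C = {0}\<close> is allowed.
\<close>

definition domination_structure :: "('a::real_normed_vector \<Rightarrow> 'a set) \<Rightarrow> bool" where
  "domination_structure Q \<longleftrightarrow>
     (\<forall>y. cone (Q y) \<and> convex (Q y) \<and> closed (Q y) \<and> Q y \<noteq> UNIV \<and> pointed (Q y))"

definition dual_cone :: "'a::real_normed_vector set \<Rightarrow> ('a \<Rightarrow>\<^sub>L real) set" where
  "dual_cone P = {ys. \<forall>y\<in>P. blinfun_apply ys y \<ge> 0}"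

definition nondominated ::
  "('b::real_normed_vector \<Rightarrow> 'b set) \<Rightarrow> ('a::real_normed_vector \<Rightarrow> 'b set) \<Rightarrow> 'a set
     \<Rightarrow> ereal \<Rightarrow> real \<Rightarrow> 'b \<Rightarrow> 'a \<Rightarrow> 'b \<Rightarrow> bool" where
  "nondominated Q F \<Omega> \<epsilon> \<delta> q xb yb \<longleftrightarrow>
     q \<noteq> 0 \<and> (xb, yb) \<in> Gr F \<inter> (\<Omega> \<times> UNIV) \<and>
     (\<forall>x \<in> eball xb \<epsilon> \<inter> \<Omega>. \<forall>y \<in> F x - {yb}. yb - \<delta> *\<^sub>R q \<notin> {y} + (Q y - {0}))"

definition aubin_property ::
  "('a::real_normed_vector \<Rightarrow> 'b::real_normed_vector set) \<Rightarrow> 'a \<Rightarrow> 'b \<Rightarrow> bool" where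
  "aubin_property F xb yb \<longleftrightarrow>
     (\<exists>l>0. \<exists>U V. open U \<and> xb \<in> U \<and> open V \<and> yb \<in> V \<and>
        (\<forall>x\<in>U. \<forall>u\<in>U. F x \<inter> V \<subseteq> F u + cball 0 (l * norm (x - u))))"

text \<open>
  The filter \<open>at x within S\<close> excludes the point \<open>x\<close> itself, where the quotient is
  undefined. At an isolated point of \<open>S\<close> the limes superior is \<open>-\<infinity>\<close>, so that the cone is
  the whole dual.
\<close>

definition frechet_normal_cone ::
  "'a::real_normed_vector set \<Rightarrow> 'a \<Rightarrow> ('a \<Rightarrow>\<^sub>L real) set" where
  "frechet_normal_cone S x =
     {xs. Limsup (at x within S) (\<lambda>u. ereal (blinfun_apply xs (u - x) / norm (u - x))) \<le> 0}"

text \<open>Weak* convergence is pointwise convergence of the functionals.\<close>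

definition limiting_normal_cone ::
  "'a::real_normed_vector set \<Rightarrow> 'a \<Rightarrow> ('a \<Rightarrow>\<^sub>L real) set" where
  "limiting_normal_cone S x =
     {xs. \<exists>(xn :: nat \<Rightarrow> 'a) (xsn :: nat \<Rightarrow> 'a \<Rightarrow>\<^sub>L real).
        xn \<longlonglongrightarrow> x \<and> (\<forall>n. xn n \<in> S) \<and>
        (\<forall>h. (\<lambda>n. blinfun_apply (xsn n) h) \<longlonglongrightarrow> blinfun_apply xs h) \<and>
        (\<forall>n. xsn n \<in> frechet_normal_cone S (xn n))}"

text \<open>
  The pair \<open>(xs, ys)\<close> seen as the functional \<open>(u, v) \<mapsto> \<langle>xs, u\<rangle> + \<langle>ys, v\<rangle>\<close> on the
  product space. The normal cones depend only on the topology, not on the choice of the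
  product norm.
\<close>

definition dual_pair ::
  "('a::real_normed_vector \<Rightarrow>\<^sub>L real) \<Rightarrow> ('b::real_normed_vector \<Rightarrow>\<^sub>L real)
     \<Rightarrow> ('a \<times> 'b) \<Rightarrow>\<^sub>L real" where
  "dual_pair xs ys = (xs o\<^sub>L fst_blinfun) + (ys o\<^sub>L snd_blinfun)"

definition frechet_coderivative ::
  "('a::real_normed_vector \<Rightarrow> 'b::real_normed_vector set) \<Rightarrow> 'a \<Rightarrow> 'b
     \<Rightarrow> ('b \<Rightarrow>\<^sub>L real) \<Rightarrow> ('a \<Rightarrow>\<^sub>L real) set" where
  "frechet_coderivative Q y z zs =
     {vs. dual_pair vs (- zs) \<in> frechet_normal_cone (Gr Q) (y, z)}"

definition limiting_coderivative ::
  "('a::real_normed_vector \<Rightarrow> 'b::real_normed_vector set) \<Rightarrow> 'a \<Rightarrow> 'b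
     \<Rightarrow> ('b \<Rightarrow>\<^sub>L real) \<Rightarrow> ('a \<Rightarrow>\<^sub>L real) set" where
  "limiting_coderivative F x y ys =
     {xs. dual_pair xs (- ys) \<in> limiting_normal_cone (Gr F) (x, y)}"

definition phi :: "real \<Rightarrow> real" where
  "phi x = 1/4 * (sqrt (1 + x) - 1) * (1 / sqrt (x + 1) - 1 / (x + 1))"

text \<open>Unspecified outside the range \<open>{0..<1/4}\<close> of \<open>phi\<close> on \<open>{0..}\<close>.\<close>

definition phi_inv :: "real \<Rightarrow> real" where
  "phi_inv = the_inv_into {0..} phi"

lemma phi_alt: "x \<ge> 0 \<Longrightarrow> phi x = ((1 - 1 / sqrt (1 + x)) / 2)\<^sup>2"
proof -
  assume x: "x \<ge> 0"
  define t where "t = sqrt (1 + x)"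
  have t: "t > 0" "x + 1 = t\<^sup>2" using x by (auto simp: t_def)
  have "phi x = 1/4 * (t - 1) * (1 / t - 1 / t\<^sup>2)"
    using t(2) by (simp add: phi_def t_def add.commute)
  also have "\<dots> = ((1 - 1 / t) / 2)\<^sup>2"
    using t(1) by (simp add: field_simps power2_eq_square)
  finally show ?thesis by (simp add: t_def)
qed

lemma phi_bij_betw: "bij_betw phi {0..} {0..<1/4}"
proof (rule bij_betw_byWitness[where f' = "\<lambda>d. 1 / (1 - 2 * sqrt d)\<^sup>2 - 1"])
  show "\<forall>x\<in>{0..}. 1 / (1 - 2 * sqrt (phi x))\<^sup>2 - 1 = x"
  proof
    fix x :: real assume "x \<in> {0..}"
    then have x: "x \<ge> 0" by simp
    have "0 \<le> (1 - 1 / sqrt (1 + x)) / 2" using x by (simp add: field_simps)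
    then have "sqrt (phi x) = (1 - 1 / sqrt (1 + x)) / 2"
      using x by (simp only: phi_alt real_sqrt_abs abs_of_nonneg)
    then have "1 - 2 * sqrt (phi x) = 1 / sqrt (1 + x)" by simp
    then show "1 / (1 - 2 * sqrt (phi x))\<^sup>2 - 1 = x"
      using x by (simp add: power_divide)
  qed
next
  have sqrt_less: "2 * sqrt d < 1" if "d < 1/4" for d :: real
    using real_sqrt_less_mono[OF that] by (simp add: real_sqrt_divide)
  have aux: "sqrt (1 / (1 - 2 * sqrt d)\<^sup>2) = 1 / (1 - 2 * sqrt d)" if "d < 1/4" for d
    using sqrt_less[OF that] by (simp add: real_sqrt_divide)
  have ge: "1 / (1 - 2 * sqrt d)\<^sup>2 - 1 \<ge> 0" if "0 \<le> d" "d < 1/4" for d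
  proof -
    have "(1 - 2 * sqrt d)\<^sup>2 \<le> 1" "(1 - 2 * sqrt d)\<^sup>2 > 0"
      using sqrt_less[OF that(2)] that(1) by (auto intro!: power_le_one)
    then show ?thesis by (simp add: field_simps)
  qed
  show "\<forall>d\<in>{0..<1/4}. phi (1 / (1 - 2 * sqrt d)\<^sup>2 - 1) = d"
    using ge aux by (auto simp: phi_alt)
  show "(\<lambda>d. 1 / (1 - 2 * sqrt d)\<^sup>2 - 1) ` {0..<1/4} \<subseteq> {0..}"
    using ge by auto
  show "phi ` {0..} \<subseteq> {0..<1/4}"
  proof clarsimp
    fix x :: real assume x: "0 \<le> x"
    have "0 \<le> (1 - 1 / sqrt (1 + x)) / 2" "(1 - 1 / sqrt (1 + x)) / 2 < 1/2"
      using x by (auto simp: field_simps)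
    then have "((1 - 1 / sqrt (1 + x)) / 2)\<^sup>2 < (1/2)\<^sup>2"
      by (intro power_strict_mono) auto
    then show "0 \<le> phi x \<and> phi x * 4 < 1"
      using x by (simp add: phi_alt power2_eq_square)
  qed
qed

lemma phi_strict_mono: "strict_mono_on {0..} phi"
proof (rule strict_mono_onI)
  fix x y :: real assume "x \<in> {0..}" "y \<in> {0..}" "x < y"
  moreover from this have "1 / sqrt (1 + y) < 1 / sqrt (1 + x)" "1 / sqrt (1 + x) \<le> 1"
    by (auto intro!: divide_strict_left_mono simp: field_simps)
  ultimately show "phi x < phi y"
    by (auto simp: phi_alt intro!: power_strict_mono)
qed

lemma phi_continuous: "continuous_on {0..} phi"
  unfolding phi_def by (intro continuous_intros) auto

end

theory Submission
  imports Defs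
begin

text \<open>
  Nondomination says that \<open>t \<ge> - \<delta>\<close> whenever \<open>y + z = yb + t q\<close> with \<open>x \<in> \<Omega>\<close>, \<open>y \<in> F x\<close>,
  \<open>z \<in> Q y\<close> and \<open>(x, y)\<close> near \<open>(xb, yb)\<close>; hence \<open>(xb, yb, 0)\<close>, where \<open>t = 0\<close>, is a \<open>\<delta>\<close>-minimiser
  of \<open>t\<close>. Adding \<open>\<kappa> \<parallel>x - xb\<parallel> + \<kappa> \<parallel>y - yb\<parallel> + \<kappa>z \<parallel>z\<parallel>\<close> to \<open>t\<close> forces the minimisers on a
  ball into its interior. By compactness this survives when every coupling between the
  variables is replaced by a smooth penalty with a large factor. In the penalised problem
  each variable ranges over one of \<open>Gr F\<close>, \<open>Gr Q\<close>, \<open>\<Omega>\<close> or a ball independently of the others,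
  so stationarity in each of them yields Frechet normals at nearby points without any
  sum rule. The multiplier paired with \<open>Q\<close> is nonnegative on \<open>Q y2 \<supseteq> P\<close>, because translation
  by elements of the convex cone \<open>Q y2\<close> stays in the graph; it only has to be rescaled
  to take the value 1 at \<open>q\<close>.
\<close>

section \<open>Finite-dimensional normed spaces: coordinates, compact balls, a smooth gauge\<close>

text \<open>The core of the equivalence of norms in finite dimension. In the induction step the
  bound for \<open>B\<close> makes the coordinates of a convergent sequence in \<open>span B\<close>
  Cauchy, so \<open>span B\<close> is closed and the new vector \<open>a\<close> has a positive
  distance from it. This distance bounds the coefficient of \<open>a\<close>, and the triangle
  inequality then handles the remaining ones.\<close>

lemma independent_coordinates_bounded:
  fixes B :: "'a::real_normed_vector set"
  assumes "finite B" "independent B"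
  shows "\<exists>c>0. \<forall>u. (\<Sum>b\<in>B. \<bar>u b\<bar>) \<le> c * norm (\<Sum>b\<in>B. u b *\<^sub>R b)"
  using assms
proof (induction B rule: finite_induct)
  case empty
  show ?case by (intro exI[of _ 1]) auto
next
  case (insert a B)
  then have a: "a \<notin> span B" and ind: "independent B"
    by (auto simp: independent_insert)
  from insert.IH[OF ind] obtain c where c: "c > 0"
    and bound: "\<And>u. (\<Sum>b\<in>B. \<bar>u b\<bar>) \<le> c * norm (\<Sum>b\<in>B. u b *\<^sub>R b)" by blast
  have "closed (span B)"
    unfolding closed_sequential_limits
  proof (intro allI impI, elim conjE)
    fix s l assume s: "\<forall>n. s n \<in> span B" and l: "s \<longlonglongrightarrow> l"
    have "\<forall>n. \<exists>u. s n = (\<Sum>b\<in>B. u b *\<^sub>R b)"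
      using s unfolding span_finite[OF insert.hyps(1)] by blast
    from choice[OF this] obtain u where u: "\<And>n. s n = (\<Sum>b\<in>B. u n b *\<^sub>R b)" by blast
    have "\<exists>v. (\<lambda>n. u n b) \<longlonglongrightarrow> v" if b: "b \<in> B" for b
    proof -
      have "Cauchy (\<lambda>n. u n b)"
      proof (rule CauchyI)
        fix e :: real assume "e > 0"
        then have "e / c > 0" using c by simp
        from CauchyD[OF LIMSEQ_imp_Cauchy[OF l] this]
        obtain M where M: "\<And>m n. m \<ge> M \<Longrightarrow> n \<ge> M \<Longrightarrow> norm (s m - s n) < e / c" by blast
        have "norm (u m b - u n b) < e" if "m \<ge> M" "n \<ge> M" for m n
        proof -
          have "norm (u m b - u n b) \<le> (\<Sum>b\<in>B. \<bar>u m b - u n b\<bar>)"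
            using b insert.hyps(1)
            by (auto intro: member_le_sum[of b B "\<lambda>b. \<bar>u m b - u n b\<bar>"])
          also have "\<dots> \<le> c * norm (\<Sum>b\<in>B. (u m b - u n b) *\<^sub>R b)" by (rule bound)
          also have "\<dots> = c * norm (s m - s n)"
            by (simp add: u sum_subtractf scaleR_left_diff_distrib)
          also have "\<dots> < e" using M[OF that] c by (simp add: field_simps)
          finally show ?thesis .
        qed
        then show "\<exists>M. \<forall>m\<ge>M. \<forall>n\<ge>M. norm (u m b - u n b) < e" by blast
      qed
      then show ?thesis using Cauchy_convergent_iff convergent_def by blast
    qed
    then have "\<forall>b\<in>B. \<exists>v. (\<lambda>n. u n b) \<longlonglongrightarrow> v" by blast
    from bchoice[OF this] obtain v where v: "\<And>b. b \<in> B \<Longrightarrow> (\<lambda>n. u n b) \<longlonglongrightarrow> v b" by blast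
    have "s \<longlonglongrightarrow> (\<Sum>b\<in>B. v b *\<^sub>R b)"
      unfolding u using v by (intro tendsto_sum tendsto_scaleR) auto
    then have "l = (\<Sum>b\<in>B. v b *\<^sub>R b)" using l LIMSEQ_unique by blast
    then show "l \<in> span B" by (auto intro: span_sum span_scale span_base)
  qed
  then obtain d where d: "d > 0" "ball a d \<inter> span B = {}"
    using a open_contains_ball_eq[of "- span B" a] by (auto simp: closed_def)
  have dist: "\<bar>t\<bar> * d \<le> norm (t *\<^sub>R a + s)" if "s \<in> span B" for t s
  proof (cases "t = 0")
    case False
    have "- (1 / t) *\<^sub>R s \<in> span B" using that by (rule span_scale)
    then have "- (1 / t) *\<^sub>R s \<notin> ball a d" using d(2) by blast
    then have "d \<le> norm (a + (1 / t) *\<^sub>R s)" by (simp add: dist_norm)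
    then have "\<bar>t\<bar> * d \<le> norm (t *\<^sub>R (a + (1 / t) *\<^sub>R s))"
      by (simp add: mult_left_mono)
    also have "t *\<^sub>R (a + (1 / t) *\<^sub>R s) = t *\<^sub>R a + s"
      using False by (simp add: scaleR_add_right)
    finally show ?thesis .
  qed simp
  show ?case
  \<comment> \<open>With \<open>w\<close> the norm of the whole combination, the coefficient of
    \<open>a\<close> costs \<open>w / d\<close>, and the rest costs \<open>c\<close> times
    \<open>w + w / d * norm a\<close>; the constant collects both.\<close>
  proof (intro exI[of _ "(1 + c * norm a) / d + c"] conjI allI)
    show "0 < (1 + c * norm a) / d + c" using c d(1) by (simp add: add_nonneg_pos)
    fix u
    define s where "s = (\<Sum>b\<in>B. u b *\<^sub>R b)"
    define w where "w = norm (u a *\<^sub>R a + s)"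
    have "s \<in> span B" unfolding s_def by (auto intro: span_sum span_scale span_base)
    then have "\<bar>u a\<bar> * d \<le> w" unfolding w_def by (rule dist)
    then have ua: "\<bar>u a\<bar> \<le> w / d" using d(1) by (simp add: field_simps)
    have "norm s \<le> w + \<bar>u a\<bar> * norm a"
      using norm_triangle_ineq4[of "u a *\<^sub>R a + s" "u a *\<^sub>R a"] by (simp add: w_def)
    also have "\<dots> \<le> w + w / d * norm a" using ua by (intro add_left_mono mult_right_mono) auto
    finally have ns: "norm s \<le> w + w / d * norm a" .
    have "(\<Sum>b\<in>insert a B. \<bar>u b\<bar>) \<le> w / d + c * norm s"
      using insert.hyps bound[of u] ua by (simp add: s_def)
    also have "\<dots> \<le> w / d + c * (w + w / d * norm a)" using ns c by simp
    also have "\<dots> = ((1 + c * norm a) / d + c) * w" using d(1) by (simp add: field_simps)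
    also have "w = norm (\<Sum>b\<in>insert a B. u b *\<^sub>R b)"
      using insert.hyps by (simp add: w_def s_def)
    finally show "(\<Sum>b\<in>insert a B. \<bar>u b\<bar>)
        \<le> ((1 + c * norm a) / d + c) * norm (\<Sum>b\<in>insert a B. u b *\<^sub>R b)" .
  qed
qed

text \<open>Continuity of the coordinates is the link between the arbitrary norm and the basis;
  compactness of balls and the smooth penalties both rest on it. For \<open>b\<close> outside the
  basis the coordinate is constantly 0, so boundedness holds for every \<open>b\<close>.\<close>

lemma finite_dim_coordinates:
  assumes "finite_dim TYPE('a::real_normed_vector)"
  obtains B :: "'a::real_normed_vector set" and r :: "'a \<Rightarrow> 'a \<Rightarrow> real"
  where "finite B" "\<And>b. bounded_linear (\<lambda>x. r x b)" "\<And>x. x = (\<Sum>b\<in>B. r x b *\<^sub>R b)"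
proof -
  from assms obtain B0 :: "'a set" where "finite B0" "span B0 = UNIV"
    unfolding finite_dim_def by blast
  moreover obtain B where "B \<subseteq> B0" "independent B" "B0 \<subseteq> span B"
    using maximal_independent_subset by blast
  ultimately have B: "finite B" "independent B" "span B = UNIV"
    using finite_subset span_mono[of B0 "span B"] by (auto simp: span_span)
  define r where "r = representation B"
  have x: "x = (\<Sum>b\<in>B. r x b *\<^sub>R b)" for x
    unfolding r_def using sum_representation_eq[OF B(2) _ B(1) subset_refl, of x] B(3) by simp
  from independent_coordinates_bounded[OF B(1,2)] obtain c where c: "c > 0"
    and bound: "\<And>u. (\<Sum>b\<in>B. \<bar>u b\<bar>) \<le> c * norm (\<Sum>b\<in>B. u b *\<^sub>R b)" by blast
  have "bounded_linear (\<lambda>x. r x b)" for b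
  proof (rule bounded_linear_intro[where K = c])
    show "r (x + y) b = r x b + r y b" for x y
      unfolding r_def by (subst representation_add[OF B(2)]) (simp_all add: B(3))
    show "r (k *\<^sub>R x) b = k *\<^sub>R r x b" for k x
      unfolding r_def by (subst representation_scale[OF B(2)]) (simp_all add: B(3))
    show "norm (r x b) \<le> norm x * c" for x
    proof (cases "b \<in> B")
      case True
      have "norm (r x b) \<le> (\<Sum>b\<in>B. \<bar>r x b\<bar>)"
        using True B(1) by (auto intro: member_le_sum[of b B "\<lambda>b. \<bar>r x b\<bar>"])
      also have "\<dots> \<le> c * norm x" using bound[of "r x"] x[of x] by simp
      finally show ?thesis by (simp add: mult.commute)
    next
      case False
      then have "r x b = 0" unfolding r_def using representation_ne_zero by blast
      then show ?thesis using c by simp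
    qed
  qed
  with B(1) x show thesis using that by blast
qed

text \<open>Bounded coordinates place the ball, as a closed subset, in a box of combinations with
  bounded coefficients. The box is compact by induction: each basis vector adds one compact interval
  to a product whose continuous image it is.\<close>

lemma finite_dim_compact_cball:
  fixes x :: "'a::real_normed_vector"
  assumes "finite_dim TYPE('a)"
  shows "compact (cball x R)"
proof -
  obtain B :: "'a set" and r where B: "finite B" and r: "\<And>b. bounded_linear (\<lambda>x. r x b)"
    and rep: "\<And>x. x = (\<Sum>b\<in>B. r x b *\<^sub>R b)"
    using finite_dim_coordinates[OF assms] by metis
  have box: "compact {\<Sum>b\<in>A. u b *\<^sub>R b | u. \<forall>b\<in>A. \<bar>u b\<bar> \<le> C b}" if "finite A" for A :: "'a set" and C
    using that
  proof (induction A rule: finite_induct)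
    case (insert a A)
    let ?K = "{\<Sum>b\<in>A. u b *\<^sub>R b | u. \<forall>b\<in>A. \<bar>u b\<bar> \<le> C b}"
    have "{\<Sum>b\<in>insert a A. u b *\<^sub>R b | u. \<forall>b\<in>insert a A. \<bar>u b\<bar> \<le> C b}
        = (\<lambda>(t, s). t *\<^sub>R a + s) ` ({- C a..C a} \<times> ?K)" (is "?L = ?R")
    proof
      show "?L \<subseteq> ?R" using insert.hyps by (force simp: image_iff abs_le_iff minus_le_iff)
      show "?R \<subseteq> ?L"
      proof clarsimp
        fix t :: real and u assume "- C a \<le> t" "t \<le> C a" "\<forall>b\<in>A. \<bar>u b\<bar> \<le> C b"
        moreover have "(\<Sum>b\<in>A. (u(a := t)) b *\<^sub>R b) = (\<Sum>b\<in>A. u b *\<^sub>R b)"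
          using insert.hyps by (intro sum.cong) auto
        ultimately show "\<exists>v. t *\<^sub>R a + (\<Sum>b\<in>A. u b *\<^sub>R b) = (\<Sum>b\<in>insert a A. v b *\<^sub>R b) \<and>
              \<bar>v a\<bar> \<le> C a \<and> (\<forall>b\<in>A. \<bar>v b\<bar> \<le> C b)"
          using insert.hyps by (intro exI[of _ "u(a := t)"]) auto
      qed
    qed
    moreover have "compact \<dots>"
      unfolding case_prod_unfold
      by (intro compact_continuous_image continuous_intros compact_Times insert.IH compact_Icc)
    ultimately show ?case by simp
  qed simp
  define K where "K b = (SOME K. \<forall>x. \<bar>r x b\<bar> \<le> norm x * K)" for b
  have K: "\<bar>r x b\<bar> \<le> norm x * K b" for x b
    unfolding K_def using someI_ex[OF bounded_linear.bounded[OF r[of b]]] by simp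
  define C where "C b = (norm x + \<bar>R\<bar>) * \<bar>K b\<bar>" for b
  have "\<bar>r y b\<bar> \<le> C b" if "y \<in> cball x R" for y b
  proof -
    have "norm y \<le> norm x + norm (x - y)" by norm
    then have "norm y \<le> norm x + \<bar>R\<bar>" using that by (simp add: dist_norm)
    then have "norm y * \<bar>K b\<bar> \<le> C b" unfolding C_def by (intro mult_right_mono) auto
    moreover have "norm y * K b \<le> norm y * \<bar>K b\<bar>" by (intro mult_left_mono) auto
    ultimately show ?thesis using K[of y b] by simp
  qed
  then have "cball x R \<subseteq> {\<Sum>b\<in>B. u b *\<^sub>R b | u. \<forall>b\<in>B. \<bar>u b\<bar> \<le> C b}"
    using rep by blast
  then have eq: "{\<Sum>b\<in>B. u b *\<^sub>R b | u. \<forall>b\<in>B. \<bar>u b\<bar> \<le> C b} \<inter> cball x R = cball x R"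
    by (rule Int_absorb1)
  show ?thesis
    using compact_Int_closed[OF box[OF B, of C] closed_cball[of x R]] unfolding eq .
qed

text \<open>An arbitrary norm may fail to be differentiable, so penalties are measured by the sum of
  the squared coordinates, which is differentiable everywhere and vanishes only at 0.\<close>

lemma finite_dim_smooth_gauge:
  assumes "finite_dim TYPE('a::real_normed_vector)"
  obtains N :: "'a::real_normed_vector \<Rightarrow> real" and J :: "'a \<Rightarrow> 'a \<Rightarrow>\<^sub>L real"
  where "\<And>x. (N has_derivative blinfun_apply (J x)) (at x)" "N 0 = 0" "\<And>x. x \<noteq> 0 \<Longrightarrow> 0 < N x"
proof -
  obtain B :: "'a set" and r where B: "finite B" and r: "\<And>b. bounded_linear (\<lambda>x. r x b)"
    and rep: "\<And>x. x = (\<Sum>b\<in>B. r x b *\<^sub>R b)"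
    using finite_dim_coordinates[OF assms] by metis
  define N where "N x = (\<Sum>b\<in>B. (r x b)\<^sup>2)" for x
  define J where "J x = Blinfun (\<lambda>h. \<Sum>b\<in>B. 2 * r x b * r h b)" for x
  have J: "blinfun_apply (J x) h = (\<Sum>b\<in>B. 2 * r x b * r h b)" for x h
    unfolding J_def
    by (subst bounded_linear_Blinfun_apply)
      (auto intro!: bounded_linear_sum bounded_linear_compose[OF bounded_linear_mult_right r])
  have "(N has_derivative blinfun_apply (J x)) (at x)" for x
    unfolding N_def J fun_eq_iff
    by (auto intro!: derivative_eq_intros bounded_linear.has_derivative[OF r]
        simp: J fun_eq_iff ac_simps)
  moreover have "N 0 = 0" by (simp add: N_def linear_0[OF bounded_linear.linear[OF r]])
  moreover have "0 < N x" if "x \<noteq> 0" for x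
  proof (rule ccontr)
    assume "\<not> 0 < N x"
    then have "N x = 0" by (simp add: N_def antisym sum_nonneg not_less)
    then have "\<forall>b\<in>B. r x b = 0" using B by (simp add: N_def sum_nonneg_eq_0_iff)
    then show False using rep[of x] that by simp
  qed
  ultimately show thesis using that by blast
qed

section \<open>Penalisation on a compact set\<close>

text \<open>A finite penalty factor suffices, so no passage to the limit is needed later. On the
  compact set \<open>K - U\<close> the points with \<open>f v \<le> f v0\<close> have
  \<open>\<psi>\<close> bounded below by some \<open>\<mu> > 0\<close>, and a large factor makes all
  of them worse than \<open>v0\<close>.\<close>

lemma penalized_minimizer_in_open:
  fixes f \<psi> :: "'a::topological_space \<Rightarrow> real"
  assumes K: "compact K" and f: "continuous_on K f" and \<psi>: "continuous_on K \<psi>"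
    and nonneg: "\<And>v. v \<in> K \<Longrightarrow> 0 \<le> \<psi> v"
    and v0: "v0 \<in> K" "\<psi> v0 = 0"
    and U: "open U" "\<And>v. v \<in> K \<Longrightarrow> \<psi> v = 0 \<Longrightarrow> f v \<le> f v0 \<Longrightarrow> v \<in> U"
  obtains c v where "c > 0" "v \<in> K" "v \<in> U" "\<And>w. w \<in> K \<Longrightarrow> f v + c * \<psi> v \<le> f w + c * \<psi> w"
proof -
  obtain m where m: "m \<in> K" "\<And>v. v \<in> K \<Longrightarrow> f m \<le> f v"
    using continuous_attains_inf[OF K _ f] v0 by blast
  have KU: "compact (K - U)" using K U(1) by (rule compact_diff)
  have "\<exists>\<mu>>0. \<forall>v\<in>K - U. f v \<le> f v0 \<longrightarrow> \<mu> \<le> \<psi> v"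
  proof (cases "K - U = {}")
    case True then show ?thesis by (intro exI[of _ 1]) auto
  next
    case False
    \<comment> \<open>\<open>g\<close> is continuous and positive on \<open>K - U\<close> and agrees
      with \<open>\<psi>\<close> where \<open>f v \<le> f v0\<close>, so its minimum serves as
      \<open>\<mu>\<close>.\<close>
    define g where "g v = max (\<psi> v) (f v - f v0)" for v
    have "continuous_on (K - U) g" unfolding g_def
      by (intro continuous_intros continuous_on_subset[OF f] continuous_on_subset[OF \<psi>]) auto
    then obtain p where p: "p \<in> K - U" "\<And>v. v \<in> K - U \<Longrightarrow> g p \<le> g v"
      using continuous_attains_inf[OF KU False] by blast
    have "g p > 0" using U(2)[of p] nonneg[of p] p(1) by (force simp: g_def less_max_iff_disj)
    moreover have "g p \<le> \<psi> v" if "v \<in> K - U" "f v \<le> f v0" for v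
      using p(2)[OF that(1)] that nonneg[of v] by (auto simp: g_def)
    ultimately show ?thesis by blast
  qed
  then obtain \<mu> where \<mu>: "\<mu> > 0" "\<And>v. v \<in> K \<Longrightarrow> v \<notin> U \<Longrightarrow> f v \<le> f v0 \<Longrightarrow> \<mu> \<le> \<psi> v" by blast
  \<comment> \<open>\<open>c * \<mu>\<close> exceeds by 1 the largest decrease
    \<open>f v0 - f m\<close> of \<open>f\<close> on \<open>K\<close>.\<close>
  define c where "c = (f v0 - f m + 1) / \<mu>"
  have c: "c > 0" using m(2)[OF v0(1)] \<mu>(1) by (simp add: c_def)
  have "continuous_on K (\<lambda>v. f v + c * \<psi> v)" by (intro continuous_intros f \<psi>)
  then obtain v where v: "v \<in> K" "\<And>w. w \<in> K \<Longrightarrow> f v + c * \<psi> v \<le> f w + c * \<psi> w"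
    using continuous_attains_inf[OF K, of "\<lambda>v. f v + c * \<psi> v"] v0 by blast
  have le: "f v + c * \<psi> v \<le> f v0" using v(2)[OF v0(1)] v0(2) by simp
  have "v \<in> U"
  proof (rule ccontr)
    assume "v \<notin> U"
    moreover have "0 \<le> c * \<psi> v" using c nonneg[OF v(1)] by simp
    ultimately have "\<mu> \<le> \<psi> v" using \<mu>(2)[OF v(1)] le by simp
    then have "c * \<mu> \<le> c * \<psi> v" using c by simp
    then show False using le m(2)[OF v(1)] \<mu>(1) by (simp add: c_def)
  qed
  with c v show thesis using that by blast
qed

section \<open>Frechet normals and first-order conditions\<close>

lemma frechet_normal_coneI:
  assumes "\<And>e. e > 0 \<Longrightarrow> \<forall>\<^sub>F u in at x within S. blinfun_apply xs (u - x) / norm (u - x) \<le> e"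
  shows "xs \<in> frechet_normal_cone S x"
proof -
  let ?L = "Limsup (at x within S) (\<lambda>u. ereal (blinfun_apply xs (u - x) / norm (u - x)))"
  have "?L \<le> 0 + ereal e" if "e > 0" for e
    using assms[OF that] by (auto intro!: Limsup_bounded)
  then have "?L \<le> 0" by (auto intro: ereal_le_epsilon2)
  then show ?thesis by (simp add: frechet_normal_cone_def)
qed

lemma frechet_normal_coneD:
  assumes "xs \<in> frechet_normal_cone S x" "e > 0"
  shows "\<forall>\<^sub>F u in at x within S. blinfun_apply xs (u - x) / norm (u - x) < e"
proof -
  have "Limsup (at x within S) (\<lambda>u. ereal (blinfun_apply xs (u - x) / norm (u - x))) < ereal e"
    using assms by (simp add: frechet_normal_cone_def le_less_trans)
  then show ?thesis by (auto dest: Limsup_lessD)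
qed

lemma frechet_normal_cone_scaleR:
  assumes "xs \<in> frechet_normal_cone S x" "t > 0"
  shows "t *\<^sub>R xs \<in> frechet_normal_cone S x"
proof (rule frechet_normal_coneI)
  fix e :: real assume "e > 0"
  then have "e / t > 0" using assms(2) by simp
  from frechet_normal_coneD[OF assms(1) this]
  show "\<forall>\<^sub>F u in at x within S. blinfun_apply (t *\<^sub>R xs) (u - x) / norm (u - x) \<le> e"
    by eventually_elim (use assms(2) in \<open>simp add: scaleR_blinfun.rep_eq field_simps\<close>)
qed

text \<open>Along the ray the quotient in the definition does not depend on \<open>t\<close>, so the
  bound on its limes superior is a bound on the value at \<open>h\<close> itself.\<close>

lemma frechet_normal_cone_le_0:
  assumes "xs \<in> frechet_normal_cone S x" and dir: "\<And>t. t > 0 \<Longrightarrow> x + t *\<^sub>R h \<in> S"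
  shows "blinfun_apply xs h \<le> 0"
proof (cases "h = 0")
  case False
  have "blinfun_apply xs h / norm h < e" if "e > 0" for e
  proof -
    have "filterlim (\<lambda>t. x + t *\<^sub>R h) (at x within S) (at_right 0)"
      unfolding filterlim_at
    proof
      show "\<forall>\<^sub>F t in at_right 0. x + t *\<^sub>R h \<in> S \<and> x + t *\<^sub>R h \<noteq> x"
        using dir False by (auto simp: eventually_at_filter)
      show "((\<lambda>t. x + t *\<^sub>R h) \<longlongrightarrow> x) (at_right 0)"
        by (auto intro!: tendsto_eq_intros)
    qed
    from eventually_compose_filterlim[OF frechet_normal_coneD[OF assms(1) that] this]
    have "\<forall>\<^sub>F t in at_right (0::real). blinfun_apply xs h / norm h < e"
      by (auto simp: eventually_at_filter blinfun.scaleR_right elim!: eventually_mono)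
    then show ?thesis by simp
  qed
  then have "blinfun_apply xs h / norm h \<le> 0" by (meson not_less_iff_gr_or_eq not_le)
  then show ?thesis using False by (simp add: divide_le_0_iff)
qed simp

text \<open>Fermat's rule: as \<open>g u - g x\<close> is nonnegative on \<open>S\<close> near
  \<open>x\<close>, the quotient for \<open>xs\<close> is at most the remainder quotient of
  \<open>g\<close>, which tends to 0.\<close>

lemma local_minimum_imp_frechet_normal:
  assumes "open U" "x \<in> U" and min: "\<And>u. u \<in> S \<Longrightarrow> u \<in> U \<Longrightarrow> g x \<le> g u"
    and g: "(g has_derivative (\<lambda>h. - blinfun_apply xs h)) (at x)"
  shows "xs \<in> frechet_normal_cone S x"
proof (rule frechet_normal_coneI)
  fix e :: real assume e: "e > 0"
  have "(g has_derivative (\<lambda>h. - blinfun_apply xs h)) (at x within S)"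
    using g by (rule has_derivative_at_withinI)
  then have "((\<lambda>u. (g u - (g x + (- blinfun_apply xs (u - x)))) /\<^sub>R norm (u - x)) \<longlongrightarrow> 0) (at x within S)"
    by (simp add: has_derivative_within divide_inverse_commute)
  then have "\<forall>\<^sub>F u in at x within S. (g u - (g x + (- blinfun_apply xs (u - x)))) /\<^sub>R norm (u - x) < e"
    using e by (rule order_tendstoD)
  moreover have "\<forall>\<^sub>F u in at x within S. u \<in> S \<and> u \<in> U \<and> u \<noteq> x"
    using assms(1,2) by (auto simp: eventually_at_topological)
  ultimately show "\<forall>\<^sub>F u in at x within S. blinfun_apply xs (u - x) / norm (u - x) \<le> e"
  proof eventually_elim
    case (elim u)
    then have "g x \<le> g u" "0 < norm (u - x)" using min by auto
    moreover have "(g u - (g x + - blinfun_apply xs (u - x))) /\<^sub>R norm (u - x)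
        = (g u - g x + blinfun_apply xs (u - x)) / norm (u - x)"
      by (simp add: divide_inverse_commute)
    moreover from calculation have "blinfun_apply xs (u - x) / norm (u - x)
        \<le> (g u - g x + blinfun_apply xs (u - x)) / norm (u - x)"
      by (intro divide_right_mono) auto
    ultimately show ?case using elim by linarith
  qed
qed

text \<open>This stands in for subgradients of the norm. If the derivative at \<open>h\<close> were
  below \<open>- k * norm h\<close>, moving along \<open>h\<close> would decrease \<open>g\<close>
  faster than the norm term can grow. Using both \<open>h\<close> and \<open>- h\<close> gives the
  bound on the dual norm.\<close>

lemma local_minimum_norm_plus_smooth:
  fixes x p :: "'a::real_normed_vector"
  assumes "open U" "x \<in> U"
    and min: "\<And>u. u \<in> U \<Longrightarrow> k * norm (x - p) + g x \<le> k * norm (u - p) + g u"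
    and k: "k \<ge> 0" and g: "(g has_derivative blinfun_apply D) (at x)"
  shows "norm D \<le> k"
proof -
  have lower: "- k * norm h \<le> blinfun_apply D h" for h
  proof (rule ccontr)
    assume neg: "\<not> ?thesis"
    \<comment> \<open>For \<open>t \<ge> 0\<close>, adding \<open>k * norm (x - p)\<close> to
      \<open>f\<close> gives a majorant of the objective along the ray that is exact at
      \<open>t = 0\<close>; hence \<open>f\<close> cannot decrease to the right of 0.\<close>
    define f where "f t = g (x + t *\<^sub>R h) + k * t * norm h" for t
    have "((\<lambda>t. x + t *\<^sub>R h) has_derivative (\<lambda>t. t *\<^sub>R h)) (at 0)"
      by (auto intro!: derivative_eq_intros)
    moreover have "(g has_derivative blinfun_apply D) (at (x + 0 *\<^sub>R h))" using g by simp
    ultimately have "((\<lambda>t. g (x + t *\<^sub>R h)) has_derivative (\<lambda>t. blinfun_apply D (t *\<^sub>R h))) (at 0)"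
      by (rule has_derivative_compose)
    then have "((\<lambda>t. g (x + t *\<^sub>R h)) has_real_derivative blinfun_apply D h) (at 0)"
      by (simp add: has_field_derivative_def blinfun.scaleR_right mult_commute_abs)
    then have "(f has_real_derivative blinfun_apply D h + k * norm h) (at 0)"
      unfolding f_def by (auto intro!: derivative_eq_intros)
    then obtain d where d: "d > 0" "\<And>t. 0 < t \<Longrightarrow> t < d \<Longrightarrow> f (0 + t) < f 0"
      using neg DERIV_neg_dec_right[of f "blinfun_apply D h + k * norm h" 0] by auto
    have "((\<lambda>t. x + t *\<^sub>R h) \<longlongrightarrow> x) (at_right 0)" by (auto intro!: tendsto_eq_intros)
    then have "\<forall>\<^sub>F t in at_right 0. x + t *\<^sub>R h \<in> U" using assms(1,2) by (rule topological_tendstoD)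
    moreover have "\<forall>\<^sub>F t in at_right 0. 0 < t \<and> t < d"
      using d(1) by (auto simp: eventually_at_right intro: exI[of _ d])
    ultimately have "\<forall>\<^sub>F t in at_right (0::real). False"
    proof eventually_elim
      case (elim t)
      have "norm (x + t *\<^sub>R h - p) \<le> norm (x - p) + t * norm h"
        using norm_triangle_ineq[of "x - p" "t *\<^sub>R h"] elim by (simp add: algebra_simps)
      then have "k * norm (x + t *\<^sub>R h - p) \<le> k * norm (x - p) + k * t * norm h"
        using k mult_left_mono[of _ _ k] by (fastforce simp: algebra_simps)
      then show False using min[of "x + t *\<^sub>R h"] d(2)[of t] elim by (simp add: f_def)
    qed
    then show False by simp
  qed
  show ?thesis
  proof (rule norm_blinfun_bound[OF k])
    fix h
    show "norm (blinfun_apply D h) \<le> k * norm h"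
      using lower[of h] lower[of "- h"] by (simp add: blinfun.minus_right abs_le_iff)
  qed
qed

lemma dual_pair_apply [simp]:
  "blinfun_apply (dual_pair xs ys) h = blinfun_apply xs (fst h) + blinfun_apply ys (snd h)"
  by (simp add: dual_pair_def blinfun.add_left fst_blinfun.rep_eq snd_blinfun.rep_eq)

lemma scaleR_dual_pair_minus:
  "t *\<^sub>R dual_pair xs (- ys) = dual_pair (t *\<^sub>R xs) (- (t *\<^sub>R ys))"
  by (rule blinfun_eqI) (simp add: blinfun.bilinear_simps algebra_simps)

lemma frechet_subset_limiting_normal_cone:
  assumes "x \<in> S"
  shows "frechet_normal_cone S x \<subseteq> limiting_normal_cone S x"
proof
  fix xs assume "xs \<in> frechet_normal_cone S x"
  then show "xs \<in> limiting_normal_cone S x"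
    unfolding limiting_normal_cone_def using assms
    by (intro CollectI exI[of _ "\<lambda>_. x"] exI[of _ "\<lambda>_. xs"]) auto
qed

section \<open>Multipliers from the penalised problem\<close>

text \<open>By the strict \<open>bounds\<close>, the norm terms on the boundary of the balls exceed
  the possible gain \<open>\<delta>\<close>. The multipliers \<xi>, \<eta>, \<open>ys\<close> belong
  to \<open>x1 = x3\<close>, \<open>y1 = y2\<close> and \<open>y1 + z2 = yb + t *\<^sub>R q\<close>;
  \<alpha>, \<beta>, \<gamma> balance the three norm terms and so are bounded by their
  weights.\<close>

lemma approximate_multiplier_rule:
  fixes \<Omega> :: "'a::real_normed_vector set" and G :: "('a \<times> 'b::real_normed_vector) set"
    and H :: "('b \<times> 'b) set" and q :: 'b
  assumes fd: "finite_dim TYPE('a)" "finite_dim TYPE('b)"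
    and closed: "closed \<Omega>" "closed G" "closed H"
    and start: "xb \<in> \<Omega>" "(xb, yb) \<in> G" "(yb, 0) \<in> H"
    and pos: "0 < \<delta>" "0 < \<kappa>" "0 < \<kappa>z" "0 < R" "0 < Rz"
    and bounds: "\<delta> < \<kappa> * R" "\<delta> < \<kappa>z * Rz"
    and value_ge: "\<And>x y z t. x \<in> \<Omega> \<Longrightarrow> (x, y) \<in> G \<Longrightarrow> (y, z) \<in> H \<Longrightarrow> x \<in> cball xb R \<Longrightarrow>
      y \<in> cball yb R \<Longrightarrow> z \<in> cball 0 Rz \<Longrightarrow> y + z = yb + t *\<^sub>R q \<Longrightarrow> - \<delta> \<le> t"
  obtains x1 y1 y2 z2 x3 and \<xi> \<alpha> :: "'a \<Rightarrow>\<^sub>L real" and \<eta> \<beta> \<gamma> ys :: "'b \<Rightarrow>\<^sub>L real"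
  where "(x1, y1) \<in> G \<inter> (ball xb R \<times> ball yb R)" "(y2, z2) \<in> H \<inter> (ball yb R \<times> ball 0 Rz)"
    "x3 \<in> \<Omega> \<inter> ball xb R" "norm \<alpha> \<le> \<kappa>" "norm \<beta> \<le> \<kappa>" "norm \<gamma> \<le> \<kappa>z" "blinfun_apply ys q = 1"
    "dual_pair (- \<xi>) (- (ys + \<eta> + \<beta>)) \<in> frechet_normal_cone G (x1, y1)"
    "dual_pair \<eta> (- (ys + \<gamma>)) \<in> frechet_normal_cone H (y2, z2)"
    "\<xi> - \<alpha> \<in> frechet_normal_cone \<Omega> x3"
proof -
  obtain NX :: "'a \<Rightarrow> real" and JX where NX: "\<And>x. (NX has_derivative blinfun_apply (JX x)) (at x)"
    "NX 0 = 0" "\<And>x. x \<noteq> 0 \<Longrightarrow> 0 < NX x"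
    using finite_dim_smooth_gauge[OF fd(1)] by blast
  obtain NY :: "'b \<Rightarrow> real" and JY where NY: "\<And>x. (NY has_derivative blinfun_apply (JY x)) (at x)"
    "NY 0 = 0" "\<And>x. x \<noteq> 0 \<Longrightarrow> 0 < NY x"
    using finite_dim_smooth_gauge[OF fd(2)] by blast
  have nonneg: "0 \<le> NX x" "0 \<le> NY y" for x y
    using NX(2) NY(2) NX(3)[of x] NY(3)[of y] by (cases "x = 0"; cases "y = 0"; simp)+
  have zero: "NX x = 0 \<longleftrightarrow> x = 0" "NY y = 0 \<longleftrightarrow> y = 0" for x y
    using NX(2) NY(2) NX(3)[of x] NY(3)[of y] by (metis less_irrefl)+
  have "continuous_on UNIV NX" "continuous_on UNIV NY"
    using has_derivative_continuous[OF NX(1)] has_derivative_continuous[OF NY(1)]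
    by (simp_all add: continuous_at_imp_continuous_on)
  then have cont: "continuous_on S g \<Longrightarrow> continuous_on S (\<lambda>v. NX (g v))"
      "continuous_on S h \<Longrightarrow> continuous_on S (\<lambda>v. NY (h v))"
    for S :: "(('a \<times> 'b) \<times> ('b \<times> 'b) \<times> 'a \<times> ('a \<times> 'b \<times> 'b) \<times> real) set" and g h
    by (auto intro: continuous_on_compose2)
  note deriv = has_derivative_eq_rhs[OF has_derivative_compose[OF _ NX(1)]]
    has_derivative_eq_rhs[OF has_derivative_compose[OF _ NY(1)]]

  \<comment> \<open>The copies \<open>a\<close>, \<open>b\<close>, \<open>c\<close> of \<open>x3\<close>, \<open>y1\<close>, \<open>z2\<close> carry the nonsmooth norms, so that the
    objective is differentiable in the variables that range over \<open>G\<close>, \<open>H\<close> and \<open>\<Omega>\<close>.\<close>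
  define f where "f = (\<lambda>((x1 :: 'a, y1 :: 'b), (y2 :: 'b, z2 :: 'b), x3 :: 'a, (a, b, c), t).
    t + \<kappa> * norm (a - xb) + \<kappa> * norm (b - yb) + \<kappa>z * norm (c :: 'b))"
  \<comment> \<open>One gauge per severed equation: \<open>\<psi>\<close> vanishes exactly when all
    copies agree and \<open>y1 + z2 = yb + t *\<^sub>R q\<close>.\<close>
  define \<psi> where "\<psi> = (\<lambda>((x1, y1), (y2, z2), x3, (a, b, c), t).
    NX (x1 - x3) + NX (x3 - a) + NY (y1 - y2) + NY (y1 - b) + NY (z2 - c)
      + NY (y1 + z2 - yb - t *\<^sub>R q))"
  \<comment> \<open>The range of \<open>t\<close> is cut off for compactness; the cut stays inactive
    because points of \<open>K\<close> with \<open>\<psi> v = 0\<close> that are no worse than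
    \<open>v0\<close> have \<open>- \<delta> \<le> t \<le> 0\<close>.\<close>
  define K where "K = (G \<inter> (cball xb R \<times> cball yb R)) \<times> (H \<inter> (cball yb R \<times> cball 0 Rz)) \<times>
    (\<Omega> \<inter> cball xb R) \<times> (cball xb R \<times> cball yb R \<times> cball (0 :: 'b) Rz) \<times> cball (0 :: real) (2 * \<delta>)"
  define U where "U = (ball xb R \<times> ball yb R) \<times> (ball yb R \<times> ball (0 :: 'b) Rz) \<times>
    ball xb R \<times> (ball xb R \<times> ball yb R \<times> ball (0 :: 'b) Rz) \<times> ball (0 :: real) (2 * \<delta>)"
  define v0 where "v0 = ((xb, yb), (yb, 0 :: 'b), xb, (xb, yb, 0 :: 'b), 0 :: real)"
  have "compact K"
    unfolding K_def
    by (intro compact_Times closed_Int_compact closed compact_cball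
        finite_dim_compact_cball[OF fd(1)] finite_dim_compact_cball[OF fd(2)])
  moreover have "continuous_on K f" "continuous_on K \<psi>"
    unfolding f_def \<psi>_def case_prod_unfold by (intro continuous_intros cont)+
  moreover have "0 \<le> \<psi> v" for v
    by (auto simp: \<psi>_def nonneg split: prod.split)
  moreover have "v0 \<in> K" "\<psi> v0 = 0"
    using start pos by (auto simp: v0_def K_def \<psi>_def NX(2) NY(2))
  moreover have "open U" unfolding U_def by (intro open_Times open_ball)
  moreover have "v \<in> U" if v: "v \<in> K" "\<psi> v = 0" "f v \<le> f v0" for v
  proof -
    have "\<exists>x1 y1 y2 z2 x3 a b c t. v = ((x1, y1), (y2, z2), x3, (a, b, c), t)"
      by (simp add: prod_eq_iff)
    then obtain x1 y1 y2 z2 x3 a b c t where v_eq: "v = ((x1, y1), (y2, z2), x3, (a, b, c), t)"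
      by blast
    have "NX (x1 - x3) = 0 \<and> NX (x3 - a) = 0 \<and> NY (y1 - y2) = 0 \<and> NY (y1 - b) = 0
        \<and> NY (z2 - c) = 0 \<and> NY (y1 + z2 - yb - t *\<^sub>R q) = 0"
      using v(2) nonneg(1)[of "x1 - x3"] nonneg(1)[of "x3 - a"] nonneg(2)[of "y1 - y2"]
        nonneg(2)[of "y1 - b"] nonneg(2)[of "z2 - c"] nonneg(2)[of "y1 + z2 - yb - t *\<^sub>R q"]
      by (simp add: \<psi>_def v_eq)
    then have eqs: "x3 = x1" "a = x1" "y2 = y1" "b = y1" "c = z2" "y1 + z2 = yb + t *\<^sub>R q"
      by (auto simp: zero algebra_simps)
    have t: "- \<delta> \<le> t"
      using v(1) eqs by (intro value_ge[of x1 y1 z2]) (auto simp: K_def v_eq)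
    have fv: "t + \<kappa> * norm (x1 - xb) + \<kappa> * norm (y1 - yb) + \<kappa>z * norm z2 \<le> 0"
      using v(3) by (simp add: f_def v_eq v0_def eqs)
    have "0 \<le> \<kappa> * norm (x1 - xb)" "0 \<le> \<kappa> * norm (y1 - yb)" "0 \<le> \<kappa>z * norm z2"
      using pos by auto
    with fv t bounds have "\<kappa> * norm (x1 - xb) < \<kappa> * R" "\<kappa> * norm (y1 - yb) < \<kappa> * R"
      "\<kappa>z * norm z2 < \<kappa>z * Rz" "\<bar>t\<bar> < 2 * \<delta>"
      using pos(1) by linarith+
    then show "v \<in> U" using pos by (simp add: U_def v_eq eqs dist_norm norm_minus_commute)
  qed
  ultimately obtain n v where n: "0 < n" and v: "v \<in> K" "v \<in> U"
    and min: "\<And>w. w \<in> K \<Longrightarrow> f v + n * \<psi> v \<le> f w + n * \<psi> w"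
    using penalized_minimizer_in_open[of K f \<psi> v0 U] by blast
  have "\<exists>x1 y1 y2 z2 x3 a b c t. v = ((x1, y1), (y2, z2), x3, (a, b, c), t)"
    by (simp add: prod_eq_iff)
  then obtain x1 y1 y2 z2 x3 a b c t where v_eq: "v = ((x1, y1), (y2, z2), x3, (a, b, c), t)"
    by blast
  note mem = v[unfolded v_eq K_def U_def]
  note simps = K_def U_def f_def \<psi>_def v_eq
  define w where "w = y1 + z2 - yb - t *\<^sub>R q"
  \<comment> \<open>Derivatives of the scaled penalty terms at the minimiser. Freezing all blocks of
    variables but one turns minimality into one stationarity condition per block.\<close>
  define \<xi> where "\<xi> = n *\<^sub>R JX (x1 - x3)"
  define \<alpha> where "\<alpha> = n *\<^sub>R JX (x3 - a)"
  define \<eta> where "\<eta> = n *\<^sub>R JY (y1 - y2)"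
  define \<beta> where "\<beta> = n *\<^sub>R JY (y1 - b)"
  define \<gamma> where "\<gamma> = n *\<^sub>R JY (z2 - c)"
  define ys where "ys = n *\<^sub>R JY w"
  note defs = w_def \<xi>_def \<alpha>_def \<eta>_def \<beta>_def \<gamma>_def ys_def
  note blin = blinfun.bilinear_simps

  have "dual_pair (- \<xi>) (- (ys + \<eta> + \<beta>)) \<in> frechet_normal_cone G (x1, y1)"
  proof (rule local_minimum_imp_frechet_normal)
    let ?g = "\<lambda>u. n * (NX (fst u - x3) + NY (snd u - y2) + NY (snd u - b)
      + NY (snd u + z2 - yb - t *\<^sub>R q))"
    show "open (ball xb R \<times> ball yb R)" "(x1, y1) \<in> ball xb R \<times> ball yb R"
      using mem by (auto intro: open_Times)
    show "?g (x1, y1) \<le> ?g u" if "u \<in> G" "u \<in> ball xb R \<times> ball yb R" for u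
      using min[of "(u, (y2, z2), x3, (a, b, c), t)"] that mem
      by (cases u) (simp add: simps algebra_simps)
    show "(?g has_derivative (\<lambda>h. - blinfun_apply (dual_pair (- \<xi>) (- (ys + \<eta> + \<beta>))) h)) (at (x1, y1))"
      by (auto intro!: derivative_eq_intros deriv simp: defs blin algebra_simps)
  qed
  moreover have "dual_pair \<eta> (- (ys + \<gamma>)) \<in> frechet_normal_cone H (y2, z2)"
  proof (rule local_minimum_imp_frechet_normal)
    let ?g = "\<lambda>u. n * (NY (y1 - fst u) + NY (snd u - c) + NY (y1 + snd u - yb - t *\<^sub>R q))"
    show "open (ball yb R \<times> ball (0 :: 'b) Rz)" "(y2, z2) \<in> ball yb R \<times> ball (0 :: 'b) Rz"
      using mem by (auto intro: open_Times)
    show "?g (y2, z2) \<le> ?g u" if "u \<in> H" "u \<in> ball yb R \<times> ball 0 Rz" for u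
      using min[of "((x1, y1), u, x3, (a, b, c), t)"] that mem
      by (cases u) (simp add: simps algebra_simps)
    show "(?g has_derivative (\<lambda>h. - blinfun_apply (dual_pair \<eta> (- (ys + \<gamma>))) h)) (at (y2, z2))"
      by (auto intro!: derivative_eq_intros deriv simp: defs blin algebra_simps)
  qed
  moreover have "\<xi> - \<alpha> \<in> frechet_normal_cone \<Omega> x3"
  proof (rule local_minimum_imp_frechet_normal)
    let ?g = "\<lambda>u. n * (NX (x1 - u) + NX (u - a))"
    show "open (ball xb R)" "x3 \<in> ball xb R" using mem by auto
    show "?g x3 \<le> ?g u" if "u \<in> \<Omega>" "u \<in> ball xb R" for u
      using min[of "((x1, y1), (y2, z2), u, (a, b, c), t)"] that mem
      by (simp add: simps algebra_simps)
    show "(?g has_derivative (\<lambda>h. - blinfun_apply (\<xi> - \<alpha>) h)) (at x3)"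
      by (auto intro!: derivative_eq_intros deriv simp: defs blin algebra_simps)
  qed
  moreover have "norm (- \<alpha>) \<le> \<kappa>"
  proof (rule local_minimum_norm_plus_smooth)
    let ?g = "\<lambda>u. n * NX (x3 - u)"
    show "open (ball xb R)" "a \<in> ball xb R" "0 \<le> \<kappa>" using mem pos by auto
    show "\<kappa> * norm (a - xb) + ?g a \<le> \<kappa> * norm (u - xb) + ?g u" if "u \<in> ball xb R" for u
      using min[of "((x1, y1), (y2, z2), x3, (u, b, c), t)"] that mem
      by (simp add: simps algebra_simps)
    show "(?g has_derivative blinfun_apply (- \<alpha>)) (at a)"
      by (auto intro!: derivative_eq_intros deriv simp: defs blin fun_eq_iff)
  qed
  moreover have "norm (- \<beta>) \<le> \<kappa>"
  proof (rule local_minimum_norm_plus_smooth)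
    let ?g = "\<lambda>u. n * NY (y1 - u)"
    show "open (ball yb R)" "b \<in> ball yb R" "0 \<le> \<kappa>" using mem pos by auto
    show "\<kappa> * norm (b - yb) + ?g b \<le> \<kappa> * norm (u - yb) + ?g u" if "u \<in> ball yb R" for u
      using min[of "((x1, y1), (y2, z2), x3, (a, u, c), t)"] that mem
      by (simp add: simps algebra_simps)
    show "(?g has_derivative blinfun_apply (- \<beta>)) (at b)"
      by (auto intro!: derivative_eq_intros deriv simp: defs blin fun_eq_iff)
  qed
  moreover have "norm (- \<gamma>) \<le> \<kappa>z"
  proof (rule local_minimum_norm_plus_smooth)
    let ?g = "\<lambda>u. n * NY (z2 - u)"
    show "open (ball (0 :: 'b) Rz)" "c \<in> ball 0 Rz" "0 \<le> \<kappa>z" using mem pos by auto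
    show "\<kappa>z * norm (c - 0) + ?g c \<le> \<kappa>z * norm (u - 0) + ?g u" if "u \<in> ball 0 Rz" for u
      using min[of "((x1, y1), (y2, z2), x3, (a, b, u), t)"] that mem
      by (simp add: simps algebra_simps)
    show "(?g has_derivative blinfun_apply (- \<gamma>)) (at c)"
      by (auto intro!: derivative_eq_intros deriv simp: defs blin fun_eq_iff)
  qed
  \<comment> \<open>Stationarity in \<open>t\<close>, an interior point of its interval: the
    derivative 1 of the objective is balanced by that of the last penalty term.\<close>
  moreover have "blinfun_apply ys q = 1"
  proof -
    let ?g = "\<lambda>s. s + n * NY (y1 + z2 - yb - s *\<^sub>R q)"
    have "(?g has_derivative (\<lambda>h. (1 - blinfun_apply ys q) * h)) (at t)"
      by (auto intro!: derivative_eq_intros deriv simp: defs blin fun_eq_iff algebra_simps)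
    then have D: "(?g has_real_derivative 1 - blinfun_apply ys q) (at t)"
      by (simp add: has_field_derivative_def)
    have le: "?g t \<le> ?g s" if "\<bar>t - s\<bar> < 2 * \<delta> - \<bar>t\<bar>" for s
    proof -
      have "s \<in> cball 0 (2 * \<delta>)" using that by auto
      then show ?thesis
        using min[of "((x1, y1), (y2, z2), x3, (a, b, c), s)"] mem
        by (simp add: simps algebra_simps)
    qed
    have "0 < 2 * \<delta> - \<bar>t\<bar>" using mem by auto
    from DERIV_local_min[OF D this] le show ?thesis by simp
  qed
  moreover have "(x1, y1) \<in> G \<inter> (ball xb R \<times> ball yb R)"
    "(y2, z2) \<in> H \<inter> (ball yb R \<times> ball 0 Rz)" "x3 \<in> \<Omega> \<inter> ball xb R"
    using mem by auto
  ultimately show thesis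
    by (intro that[of x1 y1 y2 z2 x3 \<alpha> \<beta> \<gamma> ys \<xi> \<eta>]) (simp_all only: norm_minus_cancel)
qed

section \<open>Numerical bounds behind the choice of \<open>phi\<close>\<close>

text \<open>In terms of \<open>d = sqrt (1 + r) - 1\<close> both claims become polynomial
  inequalities for \<open>d \<ge> 0\<close>. The factor 18 gives
  \<open>16 * \<delta> \<le> r - 2 * \<delta>\<close>, which matches the threshold 1/16 for
  \<epsilon>; the square root bound serves the condition on
  \<open>sqrt \<delta> - \<delta>\<close>.\<close>

lemma phi_bounds:
  assumes "0 \<le> r"
  shows "18 * phi r \<le> r" "4 * sqrt (phi r) \<le> r"
proof -
  define d where "d = sqrt (1 + r) - 1"
  have d: "0 \<le> d" "0 < 1 + d" and r: "r = d * (2 + d)"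
    using assms by (auto simp: d_def algebra_simps)
  have root: "(1 - 1 / sqrt (1 + r)) / 2 = d / (2 * (1 + d))"
    using d by (simp add: d_def field_simps)
  then have phi: "phi r = (d / (2 * (1 + d)))\<^sup>2"
    by (simp only: phi_alt[OF assms])
  have "18 * d \<le> (2 + d) * (2 * (1 + d))\<^sup>2"
  proof -
    have "(2 + d) * (2 * (1 + d))\<^sup>2 - 18 * d = 8 + 2 * d + 16 * d\<^sup>2 + 4 * d ^ 3"
      by (simp add: power2_eq_square power3_eq_cube algebra_simps)
    also have "\<dots> \<ge> 0" using d(1) by simp
    finally show ?thesis by simp
  qed
  then have "d * (18 * d) \<le> d * ((2 + d) * (2 * (1 + d))\<^sup>2)"
    using d(1) by (rule mult_left_mono)
  then have "18 * (d / (2 * (1 + d)))\<^sup>2 \<le> d * (2 + d)"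
    using d(2) by (simp add: power_divide divide_le_eq power2_eq_square[of d] mult_ac)
  then show "18 * phi r \<le> r" by (simp only: phi r[symmetric])
  have "d * 4 \<le> d * ((2 + d) * (2 * (1 + d)))"
    using d(1) by (intro mult_left_mono) (auto simp: algebra_simps)
  then have "4 * (d / (2 * (1 + d))) \<le> d * (2 + d)"
    using d(2) by (simp add: divide_le_eq mult_ac)
  moreover have "sqrt (phi r) = d / (2 * (1 + d))" using d by (simp add: phi)
  ultimately show "4 * sqrt (phi r) \<le> r" by (simp only: r[symmetric])
qed

section \<open>The multiplier rule at the nondominated point and the rescaling of its
  multipliers\<close>

theorem theorem4p15:
  fixes \<Omega> :: "'a::real_normed_vector set"
    and F :: "'a \<Rightarrow> 'b::real_normed_vector set"
    and Q :: "'b \<Rightarrow> 'b set"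
    and xb :: 'a and yb q :: 'b
    and \<epsilon> :: ereal and \<delta> :: real
    and P :: "'b set"
  assumes "finite_dim TYPE('a)" and "finite_dim TYPE('b)"
    and "closed \<Omega>" and "closed (Gr F)" and "closed (Gr Q)"
    and "domination_structure Q"
    and "xb \<in> \<Omega>" and "(xb, yb) \<in> Gr F" and "(yb, 0) \<in> Gr Q"
    and aubin: "aubin_property F xb yb" "aubin_property Q yb 0"
    and constants: "0 < \<epsilon>" "0 < \<delta>"
      "(\<epsilon> > ereal (1/16) \<and> \<delta> < 1/4) \<or> (ereal \<delta> < \<epsilon> \<and> ereal (sqrt \<delta> - \<delta>) < \<epsilon>)"
    and phi_inv_defined: "\<delta> \<in> phi ` {0..}"
    and interiority: "P = (\<Inter>y \<in> eball yb \<epsilon>. Q y)" "q \<in> sphere 0 1 \<inter> interior P"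
    and approx_sol: "nondominated Q F \<Omega> \<epsilon> \<delta> q xb yb"
  shows "\<exists>ys x1 y1 y2 z2 x3 zs y1s.
      ys \<in> dual_cone P \<and> blinfun_apply ys q = 1 \<and>
      (x1, y1) \<in> Gr F \<inter> (cball xb (phi_inv \<delta>) \<times> cball yb (phi_inv \<delta>)) \<and>
      (y2, z2) \<in> Gr Q \<inter> (cball yb (phi_inv \<delta>) \<times> cball 0 (phi_inv \<delta>)) \<and>
      x3 \<in> \<Omega> \<inter> cball xb (phi_inv \<delta>) \<and>
      zs \<in> cball 0 (2 * phi_inv \<delta>) \<and>
      y1s \<in> frechet_coderivative Q y2 z2 ys + cball 0 (phi_inv \<delta>) \<and>
      0 \<in> limiting_coderivative F x1 y1 (ys + y1s + zs)
          + limiting_normal_cone \<Omega> x3 + cball 0 (phi_inv \<delta>)"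
proof -
  define r where "r = phi_inv \<delta>"
  have r: "0 \<le> r" "phi r = \<delta>"
    using phi_inv_defined the_inv_into_f_f[OF bij_betw_imp_inj_on[OF phi_bij_betw]]
    by (auto simp: r_def phi_inv_def)
  have d18: "18 * \<delta> \<le> r" and d4: "4 * sqrt \<delta> \<le> r"
    using phi_bounds[OF r(1)] by (simp_all add: r(2))
  define v where "v = sqrt \<delta>"
  have v: "0 < v" "\<delta> = v * v" "4 * v \<le> r"
    using constants(2) d4 by (auto simp: v_def)
  \<comment> \<open>Values of \<open>phi\<close> stay below 1/4, which supplies this bound in the
    second case of \<open>constants\<close> as well.\<close>
  have "\<delta> < 1/4" using phi_inv_defined phi_bij_betw by (auto simp: bij_betw_def)
  then have v2: "v < 1/2"
    using real_sqrt_less_mono[of \<delta> "1/4"] by (simp add: v_def real_sqrt_divide)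
  have vv: "2 * (v * v) \<le> v" using mult_left_mono[of "2 * v" 1 v] v(1) v2 by simp
  \<comment> \<open>With weight \<open>2\<delta>/r\<close> on \<open>\<parallel>z\<parallel>\<close> the rescaling factor is at least \<open>(r - 2\<delta>)/r\<close>, so \<open>r - 2\<delta>\<close> is the
    largest weight whose rescaled error is at most \<open>r\<close>.\<close>
  define \<kappa> where "\<kappa> = r - 2 * \<delta>"
  have \<kappa>3: "3 * v \<le> \<kappa>" using v(2,3) vv unfolding \<kappa>_def by linarith
  have \<kappa>: "0 < \<kappa>" "16 * \<delta> \<le> \<kappa>" "0 < r" using d18 constants(2) by (auto simp: \<kappa>_def)
  \<comment> \<open>The resulting \<open>2 * \<delta> < r * \<kappa>\<close> serves twice: it gives
    \<open>\<delta> / \<kappa> < r\<close>, leaving room for the radius, and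
    \<open>2 * \<delta> / r \<le> \<kappa>\<close>, the bound for \<gamma>.\<close>
  have "(4 * v) * (2 * v) \<le> r * \<kappa>"
    using v(1,3) \<kappa>3 by (intro mult_mono) auto
  moreover have "0 < v * v" using v(1) by simp
  ultimately have r\<kappa>: "2 * \<delta> < r * \<kappa>" unfolding v(2) by simp
  \<comment> \<open>The radius \<open>R\<close> must exceed \<open>\<delta> / \<kappa>\<close> for
    the multiplier rule, stay below \<epsilon> for nondomination and for \<open>P\<close>, and stay
    below \<open>r\<close> for the final localisation.\<close>
  have "\<delta> / \<kappa> < r" using r\<kappa> \<kappa> constants(2) by (simp add: divide_less_eq)
  moreover have "ereal (\<delta> / \<kappa>) < \<epsilon>"
    using constants(3)
  proof (elim disjE conjE)
    have "\<delta> / \<kappa> \<le> 1/16" using \<kappa> by (simp add: divide_le_eq)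
    then show ?thesis if "ereal (1/16) < \<epsilon>" using le_less_trans[OF _ that] by simp
  next
    \<comment> \<open>Since \<open>\<kappa> \<ge> 4 * v - 2 * (v * v)\<close>, the goal
      \<open>v * v / \<kappa> \<le> v - v * v\<close> reduces to
      \<open>1 \<le> (1 - v) * (4 - 2 * v)\<close>, which holds for \<open>v < 1/2\<close>.\<close>
    have "v * 1 \<le> v * ((1 - v) * (4 - 2 * v))"
    proof (rule mult_left_mono)
      have "(1/2) * 3 \<le> (1 - v) * (4 - 2 * v)" using v2 by (intro mult_mono) auto
      then show "1 \<le> (1 - v) * (4 - 2 * v)" by simp
    qed (use v in simp)
    then have "v * (v * 1) \<le> v * (v * ((1 - v) * (4 - 2 * v)))"
      using v(1) by (intro mult_left_mono) auto
    also have "\<dots> = (v - v * v) * (4 * v - 2 * (v * v))" by (simp add: algebra_simps)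
    also have "\<dots> \<le> (v - v * v) * \<kappa>"
    proof (rule mult_left_mono)
      show "4 * v - 2 * (v * v) \<le> \<kappa>" using v(2,3) unfolding \<kappa>_def by linarith
      show "0 \<le> v - v * v" using vv v(1) by linarith
    qed
    finally have "v * v / \<kappa> \<le> v - v * v" using \<kappa>(1) by (simp add: divide_le_eq)
    then have "\<delta> / \<kappa> \<le> sqrt \<delta> - \<delta>" unfolding v_def[symmetric] v(2)[symmetric] .
    then show ?thesis if "ereal (sqrt \<delta> - \<delta>) < \<epsilon>"
      using le_less_trans[OF _ that] by simp
  qed
  ultimately have "ereal (\<delta> / \<kappa>) < min \<epsilon> (ereal r)" by simp
  then obtain R where R: "\<delta> / \<kappa> < R" "ereal R < \<epsilon>" "R < r"
    using ereal_dense2[of "\<delta> / \<kappa>" "min \<epsilon> (ereal r)"] by auto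
  have "0 < \<delta> / \<kappa>" using constants(2) \<kappa>(1) by simp
  then have "0 < R" using R(1) by linarith

  have P: "P \<subseteq> Q y" if "y \<in> cball yb R" for y
  proof -
    have "ereal (dist yb y) < \<epsilon>" using that R(2) le_less_trans[of "ereal (dist yb y)" "ereal R"] by simp
    then show ?thesis unfolding interiority(1) by (auto simp: eball_def)
  qed
  have q: "q \<in> P" "q \<noteq> 0" "norm q = 1"
    using interiority(2) interior_subset by auto
  have sum_in: "z + s *\<^sub>R p \<in> Q y" if "z \<in> Q y" "p \<in> Q y" "0 \<le> s" for y z s p
    using that assms(6) convex_cone[of "Q y"] by (auto simp: domination_structure_def cone_def)
  have pointed: "z = 0" if "z \<in> Q y" "- z \<in> Q y" for y z
    using that assms(6) by (force simp: domination_structure_def pointed_def)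
  have zero_in: "0 \<in> Q y" for y
    using assms(6) by (auto simp: domination_structure_def pointed_def)

  obtain x1 y1 y2 z2 x3 and \<xi> \<alpha> :: "'a \<Rightarrow>\<^sub>L real" and \<eta> \<beta> \<gamma> ys :: "'b \<Rightarrow>\<^sub>L real"
    where mem: "(x1, y1) \<in> Gr F \<inter> (ball xb R \<times> ball yb R)"
      "(y2, z2) \<in> Gr Q \<inter> (ball yb R \<times> ball 0 r)" "x3 \<in> \<Omega> \<inter> ball xb R"
      and norms: "norm \<alpha> \<le> \<kappa>" "norm \<beta> \<le> \<kappa>" "norm \<gamma> \<le> 2 * \<delta> / r"
      and ysq: "blinfun_apply ys q = 1"
      and nF: "dual_pair (- \<xi>) (- (ys + \<eta> + \<beta>)) \<in> frechet_normal_cone (Gr F) (x1, y1)"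
      and nQ: "dual_pair \<eta> (- (ys + \<gamma>)) \<in> frechet_normal_cone (Gr Q) (y2, z2)"
      and n\<Omega>: "\<xi> - \<alpha> \<in> frechet_normal_cone \<Omega> x3"
  proof (rule approximate_multiplier_rule[OF assms(1-5) assms(7-9)])
    show "0 < \<delta>" "0 < \<kappa>" "0 < 2 * \<delta> / r" "0 < R" "0 < r"
      "\<delta> < \<kappa> * R" "\<delta> < 2 * \<delta> / r * r"
      using constants(2) \<kappa> R(1) \<open>0 < R\<close> by (auto simp: field_simps)
    fix x y z t assume feas: "x \<in> \<Omega>" "(x, y) \<in> Gr F" "(y, z) \<in> Gr Q" "x \<in> cball xb R"
      "y \<in> cball yb R" "z \<in> cball 0 r" "y + z = yb + t *\<^sub>R q"
    show "- \<delta> \<le> t"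
    proof (rule ccontr)
      assume "\<not> - \<delta> \<le> t"
      then have t: "t < - \<delta>" by simp
      have qQ: "q \<in> Q y" and zQ: "z \<in> Q y" using P[OF feas(5)] q(1) feas(3) by (auto simp: Gr_def)
      \<comment> \<open>Pointedness of \<open>Q y\<close>, which contains both \<open>z\<close> and
        \<open>q\<close>. It is used twice: to see that the dominating direction is nonzero, and
        that \<open>y \<noteq> yb\<close>.\<close>
      have not_neg: "z \<noteq> - (s *\<^sub>R q)" if "0 < s" for s
        using pointed[of z y] sum_in[OF zero_in qQ, of s] zQ that q(2) by auto
      \<comment> \<open>The surplus of descent beyond \<delta> is moved along \<open>q\<close> into
        the cone, so that \<open>yb - \<delta> *\<^sub>R q\<close> is dominated by
        \<open>y\<close>.\<close>
      define s where "s = - \<delta> - t"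
      have s: "0 < s" using t by (simp add: s_def)
      have "z + s *\<^sub>R q \<in> Q y - {0}"
        using sum_in[OF zQ qQ, of s] s not_neg[OF s] by (auto simp: add_eq_0_iff2)
      moreover have "yb - \<delta> *\<^sub>R q = y + (z + s *\<^sub>R q)"
        using feas(7) by (simp add: s_def algebra_simps)
      moreover have "y \<noteq> yb"
        using feas(7) not_neg[of "- t"] t constants(2) by auto
      moreover have "x \<in> eball xb \<epsilon>"
        using feas(4) R(2) le_less_trans[of "ereal (dist xb x)" "ereal R"] by (simp add: eball_def)
      ultimately show False
        using approx_sol feas(1,2) unfolding nondominated_def
        by (force simp: Gr_def set_plus_def)
    qed
  qed

  \<comment> \<open>The functional paired with \<open>Q\<close> is \<open>ys + \<gamma>\<close>,
    whose value at \<open>q\<close> is \<open>m\<close>. Everything is divided by \<open>m\<close>,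
    and \<open>\<kappa> \<le> r * m\<close> turns errors of size \<kappa> into errors of size
    \<open>r\<close>.\<close>
  define m where "m = 1 + blinfun_apply \<gamma> q"
  have "\<bar>blinfun_apply \<gamma> q\<bar> \<le> 2 * \<delta> / r"
    using norm_blinfun[of \<gamma> q] norms(3) q(3) by simp
  then have "r - 2 * \<delta> \<le> r * m"
    using \<kappa>(3) by (simp add: m_def abs_le_iff field_simps)
  then have rm: "\<kappa> \<le> r * m" by (simp add: \<kappa>_def)
  then have "0 < r * m" using \<kappa>(1) by linarith
  then have m: "0 < m" using \<kappa>(3) by (simp add: zero_less_mult_iff)
  have "2 * \<delta> / r \<le> \<kappa>" using r\<kappa> \<kappa>(3) by (simp add: field_simps)
  then have "norm \<gamma> \<le> r * m" using norms(3) rm by linarith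
  have sc: "0 < 1 / m" using m by simp
  let ?s = "\<lambda>\<zeta>. (1 / m) *\<^sub>R \<zeta>"
  have "0 \<le> blinfun_apply (ys + \<gamma>) p" if "p \<in> P" for p
  proof -
    have "p \<in> Q y2" using P[of y2] mem(2) that by auto
    then have "blinfun_apply (dual_pair \<eta> (- (ys + \<gamma>))) (0, p) \<le> 0"
      using sum_in[of z2 y2 p] mem(2)
      by (intro frechet_normal_cone_le_0[OF nQ]) (auto simp: Gr_def)
    then show ?thesis by (simp add: blinfun.bilinear_simps)
  qed
  then have "?s (ys + \<gamma>) \<in> dual_cone P"
    using m by (simp add: dual_cone_def blinfun.scaleR_left)
  moreover have "blinfun_apply (?s (ys + \<gamma>)) q = 1"
    using m ysq by (simp add: m_def blinfun.bilinear_simps)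
  \<comment> \<open>This is \<open>zs\<close>: it accounts for the difference between
    \<open>ys + \<beta>\<close>, seen by \<open>F\<close>, and \<open>ys + \<gamma>\<close>, seen by
    \<open>Q\<close>. Each of the two errors contributes at most \<open>r\<close>.\<close>
  moreover have "?s (\<beta> - \<gamma>) \<in> cball 0 (2 * r)"
    using m norm_triangle_ineq4[of \<beta> \<gamma>] norms(2) rm \<open>norm \<gamma> \<le> r * m\<close>
    by (simp add: divide_le_eq)
  moreover have "?s \<eta> \<in> frechet_coderivative Q y2 z2 (?s (ys + \<gamma>)) + cball 0 r"
  proof -
    have "?s \<eta> \<in> frechet_coderivative Q y2 z2 (?s (ys + \<gamma>))"
      using frechet_normal_cone_scaleR[OF nQ sc]
      by (simp only: frechet_coderivative_def scaleR_dual_pair_minus mem_Collect_eq)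
    then have "?s \<eta> + 0 \<in> frechet_coderivative Q y2 z2 (?s (ys + \<gamma>)) + cball 0 r"
      using \<kappa>(3) by (intro set_plus_intro) auto
    then show ?thesis by simp
  qed
  moreover have "0 \<in> limiting_coderivative F x1 y1 (?s (ys + \<gamma>) + ?s \<eta> + ?s (\<beta> - \<gamma>))
      + limiting_normal_cone \<Omega> x3 + cball 0 r"
  proof -
    have "?s (dual_pair (- \<xi>) (- (ys + \<eta> + \<beta>))) \<in> limiting_normal_cone (Gr F) (x1, y1)"
      using frechet_normal_cone_scaleR[OF nF sc] mem(1) frechet_subset_limiting_normal_cone by blast
    moreover have "?s (ys + \<gamma>) + ?s \<eta> + ?s (\<beta> - \<gamma>) = ?s (ys + \<eta> + \<beta>)"
      by (simp add: algebra_simps)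
    ultimately have "?s (- \<xi>) \<in> limiting_coderivative F x1 y1 (?s (ys + \<gamma>) + ?s \<eta> + ?s (\<beta> - \<gamma>))"
      by (simp only: limiting_coderivative_def scaleR_dual_pair_minus mem_Collect_eq)
    moreover have "?s (\<xi> - \<alpha>) \<in> limiting_normal_cone \<Omega> x3"
      using frechet_normal_cone_scaleR[OF n\<Omega> sc] mem(3) frechet_subset_limiting_normal_cone by blast
    moreover have "?s \<alpha> \<in> cball 0 r"
      using m norms(1) rm by (simp add: divide_le_eq)
    \<comment> \<open>The sum is 0: \<xi> cancels between \<open>F\<close> and \<Omega>, and the
      ball absorbs the remaining \<alpha>.\<close>
    ultimately have "?s (- \<xi>) + ?s (\<xi> - \<alpha>) + ?s \<alpha> \<in>
        limiting_coderivative F x1 y1 (?s (ys + \<gamma>) + ?s \<eta> + ?s (\<beta> - \<gamma>))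
        + limiting_normal_cone \<Omega> x3 + cball 0 r"
      by (intro set_plus_intro)
    then show ?thesis by (simp add: algebra_simps)
  qed
  moreover have "(x1, y1) \<in> Gr F \<inter> (cball xb r \<times> cball yb r)"
    "(y2, z2) \<in> Gr Q \<inter> (cball yb r \<times> cball 0 r)" "x3 \<in> \<Omega> \<inter> cball xb r"
    using mem R(3) by auto
  ultimately show ?thesis unfolding r_def[symmetric] by blast
qed

end
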